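(* For the $2\times n$ grid graph $G_{2,n}=P_2\square P_n$ ($n\ge 1$), we have $\gamma_{MR}(G_{2,4})=2$, and $\gamma_{MR}(G_{2,n})\le 1$ for all positive integers $n\ne 4$.
   Context: All graphs are finite and simple. For a vertex $v$ of $G=(V,E)$, $N[v]=\{v\}\cup\{u: uv\in E\}$ is the closed neighborhood, and for $f:V\to\mathbb{R}$ and $S\subseteq V$, $f(S)=\sum_{x\in S}f(x)$. A majority Roman dominating function (MRDF) on $G$ is a function $f:V\to\{-1,1,2\}$ such that (i) $f(N[v])\ge 1$ for at least half of the vertices $v\in V$, and (ii) every vertex $u$ with $f(u)=-1$ is adjacent to at least one vertex $w$ with $f(w)=2$. The weight of $f$ is $f(V)$, and the majority Roman domination number $\gamma_{MR}(G)$ is the minimum weight of an MRDF on $G$. $P_n$ is the path on $n$ vertices and $\square$ denotes the Cartesian product of graphs: $(u_1,v_1)$ and $(u_2,v_2)$ are adjacent iff $u_1=u_2$ and $v_1v_2$ is an edge, or $v_1=v_2$ and $u_1u_2$ is an edge. *)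

theory Defs
  imports Complex_Main "Graph_Theory.Pair_Digraph"
begin

text \<open>
  A finite simple graph is a record satisfying the locale \<^locale>\<open>pair_graph\<close>: an edge
  \<open>uv\<close> is the pair of opposite arcs \<open>(u, v)\<close> and \<open>(v, u)\<close>.
\<close>

definition path_graph :: "nat \<Rightarrow> nat pair_pre_digraph" where
  "path_graph n =
     \<lparr> pverts = {1..n},
       parcs = {(i, j). i \<in> {1..n} \<and> j \<in> {1..n} \<and> (j = i + 1 \<or> i = j + 1)} \<rparr>"

definition cartesian_product ::
    "'a pair_pre_digraph \<Rightarrow> 'b pair_pre_digraph \<Rightarrow> ('a \<times> 'b) pair_pre_digraph"  (infixr "\<box>" 75) where
  "G \<box> H =
     \<lparr> pverts = pverts G \<times> pverts H,
       parcs = {((u1, v1), (u2, v2)).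
                  (u1 = u2 \<and> u1 \<in> pverts G \<and> (v1, v2) \<in> parcs H) \<or>
                  (v1 = v2 \<and> v1 \<in> pverts H \<and> (u1, u2) \<in> parcs G)} \<rparr>"

definition grid_graph :: "nat \<Rightarrow> nat \<Rightarrow> (nat \<times> nat) pair_pre_digraph" where
  "grid_graph m n = path_graph m \<box> path_graph n"

definition closed_neighborhood :: "'a pair_pre_digraph \<Rightarrow> 'a \<Rightarrow> 'a set" where
  "closed_neighborhood G v = {v} \<union> {u. (u, v) \<in> parcs G}"

definition majority_roman_dominating :: "'a pair_pre_digraph \<Rightarrow> ('a \<Rightarrow> int) \<Rightarrow> bool" where
  "majority_roman_dominating G f \<longleftrightarrow>
     (\<forall>v \<in> pverts G. f v \<in> {- 1, 1, 2}) \<and>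
     real (card {v \<in> pverts G. sum f (closed_neighborhood G v) \<ge> 1}) \<ge> real (card (pverts G)) / 2 \<and>
     (\<forall>u \<in> pverts G. f u = - 1 \<longrightarrow> (\<exists>w \<in> pverts G. (u, w) \<in> parcs G \<and> f w = 2))"

definition majority_roman_domination_number :: "'a pair_pre_digraph \<Rightarrow> int" where
  "majority_roman_domination_number G = Min {sum f (pverts G) | f. majority_roman_dominating G f}"

lemma pair_graph_path_graph: "pair_graph (path_graph n)"
proof
  show "finite (parcs (path_graph n))"
    by (rule finite_subset[of _ "{1..n} \<times> {1..n}"]) (auto simp: path_graph_def)
  show "symmetric (with_proj (path_graph n))"
    by (auto simp: path_graph_def symmetric_def sym_def)
qed (auto simp: path_graph_def)

lemma pair_graph_cartesian_product:
  assumes "pair_graph G" "pair_graph H"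
  shows "pair_graph (G \<box> H)"
proof -
  interpret G: pair_graph G by fact
  interpret H: pair_graph H by fact
  have sub: "parcs (G \<box> H) \<subseteq> (pverts G \<times> pverts H) \<times> (pverts G \<times> pverts H)"
    by (auto simp: cartesian_product_def dest: G.wellformed' H.wellformed')
  show ?thesis
  proof
    show "finite (parcs (G \<box> H))"
      by (rule finite_subset[OF sub]) (simp add: G.pair_finite_verts H.pair_finite_verts)
    show "symmetric (with_proj (G \<box> H))"
      using G.pair_sym_arcs H.pair_sym_arcs
      by (auto simp: cartesian_product_def symmetric_def sym_def)
  next
    fix e assume "e \<in> parcs (G \<box> H)"
    then show "fst e \<noteq> snd e"
      by (auto simp: cartesian_product_def dest: G.pair_no_loops H.pair_no_loops)
  qed (auto simp: cartesian_product_def G.pair_finite_verts H.pair_finite_verts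
           dest: G.wellformed' H.wellformed')
qed

text \<open>
  The set of weights is finite and nonempty, so that \<^const>\<open>Min\<close> is the true minimum.
\<close>

lemma finite_majority_roman_weights:
  assumes "finite (pverts G)"
  shows "finite {sum f (pverts G) | f. majority_roman_dominating G f}"
proof (rule finite_subset)
  let ?k = "int (card (pverts G))"
  show "{sum f (pverts G) | f. majority_roman_dominating G f} \<subseteq> {- ?k .. 2 * ?k}"
  proof clarify
    fix f assume "majority_roman_dominating G f"
    then have *: "\<And>v. v \<in> pverts G \<Longrightarrow> - 1 \<le> f v \<and> f v \<le> 2"
      by (fastforce simp: majority_roman_dominating_def)
    have "?k * (- 1) \<le> sum f (pverts G)"
      using * by (intro sum_bounded_below) auto
    moreover have "sum f (pverts G) \<le> ?k * 2"
      using * by (intro sum_bounded_above) auto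
    ultimately show "sum f (pverts G) \<in> {- ?k .. 2 * ?k}" by simp
  qed
qed simp

lemma majority_roman_dominating_one:
  assumes "pair_graph G"
  shows "majority_roman_dominating G (\<lambda>_. 1)"
proof -
  interpret pair_graph G by fact
  have "finite (closed_neighborhood G v)" for v
    by (rule finite_subset[of _ "insert v (pverts G)"])
       (auto simp: closed_neighborhood_def pair_finite_verts dest: wellformed')
  moreover have "closed_neighborhood G v \<noteq> {}" for v
    by (simp add: closed_neighborhood_def)
  ultimately have "1 \<le> card (closed_neighborhood G v)" for v
    by (simp add: Suc_le_eq card_gt_0_iff)
  then have "(\<Sum>x \<in> closed_neighborhood G v. 1 :: int) \<ge> 1" for v
    by simp
  then show ?thesis
    by (simp add: majority_roman_dominating_def)
qed

end

theory Submission
  imports Defs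
begin

text \<open>
  A labelling of the \<open>2 \<times> n\<close> grid is a word of \<open>n\<close> columns, padded by a zero column at both ends.
  Both the Roman condition and the number of vertices with \<open>f(N[v]) \<ge> 1\<close> are read off the windows
  of three consecutive columns. Four columns of weight \<open>0\<close> that contain four such vertices can be
  repeated arbitrarily often after the columns \<open>(1, -1), (-1, 2)\<close>, because they end in these same
  columns; four choices of the two ends of the word give every \<open>n \<ge> 2\<close> except \<open>4\<close>. For
  \<open>n = 4\<close> the labellings are enumerated.
\<close>

section \<open>Words of columns and their window conditions\<close>

type_synonym column = "int \<times> int"

fun admissible :: "column \<Rightarrow> column \<Rightarrow> column \<Rightarrow> bool" where
  "admissible (a, a') (b, b') (c, c') \<longleftrightarrow>
     (b = - 1 \<or> b = 1 \<or> b = 2) \<and> (b' = - 1 \<or> b' = 1 \<or> b' = 2) \<and>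
     (b = - 1 \<longrightarrow> a = 2 \<or> b' = 2 \<or> c = 2) \<and> (b' = - 1 \<longrightarrow> a' = 2 \<or> b = 2 \<or> c' = 2)"

fun satisfied :: "column \<Rightarrow> column \<Rightarrow> column \<Rightarrow> int" where
  "satisfied (a, a') (b, b') (c, c') =
     (if 1 \<le> a + b + c + b' then 1 else 0) + (if 1 \<le> a' + b' + c' + b then 1 else 0)"

fun all_admissible :: "column list \<Rightarrow> bool" where
  "all_admissible (a # b # c # cs) \<longleftrightarrow> admissible a b c \<and> all_admissible (b # c # cs)"
| "all_admissible _ \<longleftrightarrow> True"

fun total_satisfied :: "column list \<Rightarrow> int" where
  "total_satisfied (a # b # c # cs) = satisfied a b c + total_satisfied (b # c # cs)"
| "total_satisfied _ = 0"

fun weight :: "column list \<Rightarrow> int" where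
  "weight [] = 0"
| "weight ((a, b) # cs) = a + b + weight cs"

text \<open>The value 0 adds nothing to a neighborhood sum and is never 2, so the end columns need
  no case distinction. Every column of the word becomes the middle of exactly one window.\<close>

definition pad :: "column list \<Rightarrow> column list" where
  "pad cs = (0, 0) # cs @ [(0, 0)]"

text \<open>\<open>length cs\<close> is half the number of vertices, since each column holds
  two.\<close>

definition majority_roman_word :: "column list \<Rightarrow> bool" where
  "majority_roman_word cs \<longleftrightarrow> all_admissible (pad cs) \<and> int (length cs) \<le> total_satisfied (pad cs)"

text \<open>The left padding shifts positions by one, so \<open>pad cs ! j\<close> is the column
  with the 1-based index \<open>j\<close> used by \<open>path_graph\<close>.\<close>

definition word_labelling :: "column list \<Rightarrow> nat \<times> nat \<Rightarrow> int" where
  "word_labelling cs = (\<lambda>(i, j). (if i = 1 then fst else snd) (pad cs ! j))"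

text \<open>The recursions are convenient for computing with explicit words; this indexed form and
  the next two connect them with the vertices of the grid. Lists with fewer than three columns have
  no window, in agreement with the truncated \<open>length l - 2\<close>.\<close>

lemma all_admissible_nth:
  "all_admissible l \<longleftrightarrow> (\<forall>j < length l - 2. admissible (l ! j) (l ! Suc j) (l ! Suc (Suc j)))"
  by (induction l rule: all_admissible.induct) (auto simp: All_less_Suc2)

lemma total_satisfied_nth:
  "total_satisfied l = (\<Sum>j < length l - 2. satisfied (l ! j) (l ! Suc j) (l ! Suc (Suc j)))"
  by (induction l rule: total_satisfied.induct) (simp_all add: sum.lessThan_Suc_shift del: sum.lessThan_Suc)

lemma weight_nth: "weight cs = (\<Sum>j < length cs. fst (cs ! j) + snd (cs ! j))"
  by (induction cs rule: weight.induct) (simp_all add: sum.lessThan_Suc_shift del: sum.lessThan_Suc)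

section \<open>The two-row grid and the labelling given by a word\<close>

lemma pverts_grid: "pverts (grid_graph 2 n) = {1, 2} \<times> Suc ` {..<n}"
proof -
  have "{1..2::nat} = {1, 2}" by auto
  then show ?thesis
    by (simp add: grid_graph_def cartesian_product_def path_graph_def image_Suc_lessThan)
qed

lemma pair_graph_grid: "pair_graph (grid_graph m n)"
  by (simp add: grid_graph_def pair_graph_cartesian_product pair_graph_path_graph)

lemma finite_grid: "finite (pverts (grid_graph m n))"
  by (simp add: grid_graph_def cartesian_product_def path_graph_def)

text \<open>The rows are 1 and 2, so a row sum of 3 means opposite rows; accordingly
  \<open>3 - i\<close> denotes the row opposite to \<open>i\<close> below.\<close>

lemma parcs_grid:
  "(u, v) \<in> parcs (grid_graph 2 n) \<longleftrightarrow> u \<in> pverts (grid_graph 2 n) \<and> v \<in> pverts (grid_graph 2 n) \<and>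
     (fst u = fst v \<and> (snd v = Suc (snd u) \<or> snd u = Suc (snd v)) \<or>
      snd u = snd v \<and> fst u + fst v = 3)"
  by (cases u; cases v)
     (auto simp: grid_graph_def cartesian_product_def path_graph_def; presburger)

lemma card_filter_columns:
  "int (card {v \<in> {1, 2::nat} \<times> Suc ` {..<n}. P v}) =
   (\<Sum>j < n. (if P (1, Suc j) then 1 else 0) + (if P (2, Suc j) then 1 else 0))"
proof -
  have "int (card {v \<in> {1, 2::nat} \<times> Suc ` {..<n}. P v}) =
      (\<Sum>v \<in> {1, 2} \<times> Suc ` {..<n}. if P v then 1 else 0)"
    by (simp add: sum.If_cases Int_def)
  also have "\<dots> = (\<Sum>i \<in> {1, 2}. \<Sum>j \<in> Suc ` {..<n}. if P (i, j) then 1 else 0)"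
    by (simp only: sum.cartesian_product) (simp add: case_prod_unfold)
  finally show ?thesis
    by (simp add: sum.reindex sum.distrib)
qed

context
  fixes cs :: "column list" and f n
  defines "n \<equiv> length cs" and "f \<equiv> word_labelling cs"
begin

lemma f_boundary: "f (i, 0) = 0" "f (i, Suc n) = 0"
  by (simp_all add: f_def word_labelling_def pad_def n_def nth_append)

text \<open>Of the four positions, only the horizontal neighbors can leave the grid; they then lie
  in column 0 or \<open>Suc n\<close>, where \<open>f\<close> vanishes.\<close>

lemma sum_closed_neighborhood_word:
  assumes "i \<in> {1, 2}" "j < n"
  shows "sum f (closed_neighborhood (grid_graph 2 n) (i, Suc j)) =
         f (i, j) + f (i, Suc j) + f (i, Suc (Suc j)) + f (3 - i, Suc j)"
proof -
  let ?S = "{(i, j), (i, Suc j), (i, Suc (Suc j)), (3 - i, Suc j)}"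
  have N: "closed_neighborhood (grid_graph 2 n) (i, Suc j) = ?S \<inter> pverts (grid_graph 2 n)"
    using assms by (auto simp: closed_neighborhood_def parcs_grid pverts_grid)
  have "sum f (closed_neighborhood (grid_graph 2 n) (i, Suc j)) = sum f ?S"
    unfolding N
  proof (rule sum.mono_neutral_left)
    show "\<forall>v \<in> ?S - ?S \<inter> pverts (grid_graph 2 n). f v = 0"
    proof
      fix v assume v: "v \<in> ?S - ?S \<inter> pverts (grid_graph 2 n)"
      then have "v = (i, 0) \<or> v = (i, Suc n)"
        using assms by (cases j) (auto simp: pverts_grid less_Suc_eq image_iff)
      then show "f v = 0" using f_boundary by auto
    qed
  qed auto
  also have "\<dots> = f (i, j) + f (i, Suc j) + f (i, Suc (Suc j)) + f (3 - i, Suc j)"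
    using assms by auto
  finally show ?thesis .
qed

text \<open>A padding entry is 0, so a position carrying the value 2 lies inside the grid.\<close>

lemma roman_neighbor_word:
  assumes "i \<in> {1, 2}" "j < n"
  shows "(\<exists>w \<in> pverts (grid_graph 2 n). ((i, Suc j), w) \<in> parcs (grid_graph 2 n) \<and> f w = 2) \<longleftrightarrow>
         f (i, j) = 2 \<or> f (3 - i, Suc j) = 2 \<or> f (i, Suc (Suc j)) = 2"
  (is "?L \<longleftrightarrow> ?R")
proof
  assume ?L
  then show ?R
    using assms by (auto simp: parcs_grid pverts_grid)
next
  have mem: "(i', Suc j') \<in> pverts (grid_graph 2 n) \<longleftrightarrow> i' \<in> {1, 2} \<and> j' < n" for i' j'
    by (auto simp: pverts_grid)
  assume ?R
  then consider "f (i, j) = 2" | "f (3 - i, Suc j) = 2" | "f (i, Suc (Suc j)) = 2"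
    by blast
  then show ?L
  proof cases
    case 1
    then obtain j' where "j = Suc j'" using f_boundary by (cases j) auto
    then show ?thesis
      using 1 assms by (intro bexI[of _ "(i, j)"]) (auto simp: parcs_grid mem)
  next
    case 2
    then show ?thesis
      using assms by (intro bexI[of _ "(3 - i, Suc j)"]) (auto simp: parcs_grid mem)
  next
    case 3
    then have "Suc j \<noteq> n" using f_boundary by auto
    then show ?thesis
      using 3 assms by (intro bexI[of _ "(i, Suc (Suc j))"]) (auto simp: parcs_grid mem)
  qed
qed

lemma majority_roman_dominating_word_iff:
  "majority_roman_dominating (grid_graph 2 n) f \<longleftrightarrow> majority_roman_word cs"
proof -
  let ?c = "\<lambda>j. pad cs ! j"
  have len: "length (pad cs) - 2 = n" by (simp add: pad_def n_def)
  have f: "f (1, j) = fst (?c j)" "f (2, j) = snd (?c j)"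
    "f (Suc 0, j) = fst (?c j)" for j
    by (simp_all add: f_def word_labelling_def)
  have adm: "admissible a b c \<longleftrightarrow>
     fst b \<in> {-1, 1, 2} \<and> snd b \<in> {-1, 1, 2} \<and>
     (fst b = - 1 \<longrightarrow> fst a = 2 \<or> snd b = 2 \<or> fst c = 2) \<and>
     (snd b = - 1 \<longrightarrow> snd a = 2 \<or> fst b = 2 \<or> snd c = 2)" for a b c
    by (cases a; cases b; cases c) simp
  have sat: "satisfied a b c =
     (if 1 \<le> fst a + fst b + fst c + snd b then 1 else 0) +
     (if 1 \<le> snd a + snd b + snd c + fst b then 1 else 0)" for a b c
    by (cases a; cases b; cases c) simp
  have columns: "(\<forall>v \<in> pverts (grid_graph 2 n). P v) \<longleftrightarrow> (\<forall>j<n. P (1, Suc j) \<and> P (2, Suc j))" for P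
    by (auto simp: pverts_grid)
  \<comment> \<open>Window \<open>j\<close> is centred at column \<open>Suc j\<close> and carries
    the local conditions at its two vertices: the allowed values and the Roman condition. The
    majority condition is global and is treated in \<open>B\<close>.\<close>
  have A: "(\<forall>v \<in> pverts (grid_graph 2 n). f v \<in> {- 1, 1, 2}) \<and>
      (\<forall>u \<in> pverts (grid_graph 2 n). f u = - 1 \<longrightarrow>
        (\<exists>w \<in> pverts (grid_graph 2 n). (u, w) \<in> parcs (grid_graph 2 n) \<and> f w = 2)) \<longleftrightarrow>
      all_admissible (pad cs)"
    unfolding columns all_admissible_nth len adm
    using roman_neighbor_word[of 1] roman_neighbor_word[of 2] by (auto simp: f)
  have "card (pverts (grid_graph 2 n)) = 2 * n"
    by (simp add: pverts_grid card_cartesian_product card_image)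
  moreover have "int (card {v \<in> pverts (grid_graph 2 n).
      sum f (closed_neighborhood (grid_graph 2 n) v) \<ge> 1}) = total_satisfied (pad cs)"
    unfolding pverts_grid card_filter_columns total_satisfied_nth len sat
    by (rule sum.cong) (simp_all add: sum_closed_neighborhood_word f)
  ultimately have B: "real (card {v \<in> pverts (grid_graph 2 n).
      sum f (closed_neighborhood (grid_graph 2 n) v) \<ge> 1}) \<ge> real (card (pverts (grid_graph 2 n))) / 2 \<longleftrightarrow>
      int (length cs) \<le> total_satisfied (pad cs)"
    unfolding n_def by linarith
  show ?thesis
    unfolding majority_roman_dominating_def majority_roman_word_def A[symmetric] B by blast
qed

lemma sum_word_labelling: "sum f (pverts (grid_graph 2 n)) = weight cs"
proof -
  have "sum f (pverts (grid_graph 2 n)) = (\<Sum>i \<in> {1, 2}. \<Sum>j \<in> Suc ` {..<n}. f (i, j))"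
    unfolding pverts_grid by (simp only: sum.cartesian_product) simp
  also have "\<dots> = (\<Sum>j<n. f (1, Suc j) + f (2, Suc j))"
    by (simp add: sum.reindex sum.distrib)
  also have "\<dots> = weight cs"
    unfolding weight_nth n_def
    by (rule sum.cong) (simp_all add: f_def word_labelling_def pad_def nth_append)
  finally show ?thesis .
qed

end

section \<open>Bounds on the domination number through words\<close>

lemma majority_roman_dominating_cong:
  assumes "pair_graph G" and eq: "\<And>v. v \<in> pverts G \<Longrightarrow> f v = g v"
  shows "majority_roman_dominating G f \<longleftrightarrow> majority_roman_dominating G g"
proof -
  interpret pair_graph G by fact
  have "sum f (closed_neighborhood G v) = sum g (closed_neighborhood G v)" if "v \<in> pverts G" for v
    using that by (intro sum.cong) (auto simp: closed_neighborhood_def eq dest: wellformed')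
  then show ?thesis
    unfolding majority_roman_dominating_def by (simp add: eq cong: conj_cong Collect_cong)
qed

lemma majority_roman_domination_number_le_weight:
  assumes "majority_roman_word cs" "length cs = n"
  shows "majority_roman_domination_number (grid_graph 2 n) \<le> weight cs"
proof -
  let ?f = "word_labelling cs"
  have "majority_roman_dominating (grid_graph 2 n) ?f"
    using assms majority_roman_dominating_word_iff[of cs] by simp
  moreover have "weight cs = sum ?f (pverts (grid_graph 2 n))"
    using assms sum_word_labelling[of cs] by simp
  ultimately show ?thesis
    unfolding majority_roman_domination_number_def
    by (intro Min_le finite_majority_roman_weights finite_grid) blast
qed

text \<open>Reading off the columns of an arbitrary labelling gives a word whose labelling agrees
  with it on all vertices. Closed neighborhoods of vertices stay inside the graph, so this agreement
  transfers the domination property to the word.\<close>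

lemma majority_roman_domination_number_ge:
  assumes "\<And>cs. length cs = n \<Longrightarrow> majority_roman_word cs \<Longrightarrow> k \<le> weight cs"
  shows "k \<le> majority_roman_domination_number (grid_graph 2 n)"
proof -
  let ?G = "grid_graph 2 n"
  let ?W = "{sum f (pverts ?G) | f. majority_roman_dominating ?G f}"
  have "?W \<noteq> {}"
    using majority_roman_dominating_one[OF pair_graph_grid] by blast
  moreover have "k \<le> sum f (pverts ?G)" if f: "majority_roman_dominating ?G f" for f
  proof -
    define cs where "cs = map (\<lambda>j. (f (1, Suc j), f (2, Suc j))) [0..<n]"
    have len: "length cs = n" by (simp add: cs_def)
    have eq: "f v = word_labelling cs v" if "v \<in> pverts ?G" for v
      using that by (auto simp: pverts_grid word_labelling_def pad_def nth_append cs_def)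
    have "majority_roman_word cs"
      using f majority_roman_dominating_cong[OF pair_graph_grid eq]
        majority_roman_dominating_word_iff[of cs] len by simp
    then have "k \<le> weight cs" using assms len by blast
    also have "weight cs = sum f (pverts ?G)"
      using sum_word_labelling[of cs] len by (simp add: eq)
    finally show ?thesis .
  qed
  ultimately show ?thesis
    unfolding majority_roman_domination_number_def
    by (subst Min_ge_iff) (auto simp: finite_majority_roman_weights finite_grid)
qed

section \<open>Periodic words\<close>

definition block :: "column list" where
  "block = [(- 1, - 1), (2, - 1), (1, - 1), (- 1, 2)]"

definition blocks :: "nat \<Rightarrow> column list" where
  "blocks k = concat (replicate k block)"

lemma blocks_simps: "blocks 0 = []" "blocks (Suc k) = block @ blocks k"
  by (simp_all add: blocks_def)

lemma length_blocks: "length (blocks k) = 4 * k"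
  by (induction k) (simp_all add: blocks_simps block_def)

lemma weight_blocks: "weight (blocks k @ cs) = weight cs"
  by (induction k) (simp_all add: blocks_simps block_def)

text \<open>The four windows starting at the two prefix columns and the first two columns of a block
  are admissible. What remains begins with the last two columns of that block, which equal the
  prefix, so induction removes one block at a time.\<close>

lemma all_admissible_blocks:
  "all_admissible ((1, - 1) # (- 1, 2) # blocks k @ cs) \<longleftrightarrow> all_admissible ((1, - 1) # (- 1, 2) # cs)"
  by (induction k) (simp_all add: blocks_simps block_def)

text \<open>The same induction: the four windows removed with a block count 1, 0, 1 and 2
  vertices.\<close>

lemma total_satisfied_blocks:
  "total_satisfied ((1, - 1) # (- 1, 2) # blocks k @ cs) =
   4 * int k + total_satisfied ((1, - 1) # (- 1, 2) # cs)"
  by (induction k) (simp_all add: blocks_simps block_def)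

lemmas word_blocks_simps =
  majority_roman_word_def pad_def length_blocks weight_blocks
  all_admissible_blocks total_satisfied_blocks

section \<open>The lower bound for four columns\<close>

lemma weight_ge_two_of_four_columns:
  assumes len: "length cs = 4" and cs: "majority_roman_word cs"
  shows "2 \<le> weight cs"
proof -
  let ?C = "List.product [- 1, 1, 2 :: int] [- 1, 1, 2 :: int]"
  \<comment> \<open>Nine possible columns in each of four places: 6561 words, checked by
    evaluation.\<close>
  have *: "list_all (\<lambda>a. list_all (\<lambda>b. list_all (\<lambda>c. list_all (\<lambda>d.
      majority_roman_word [a, b, c, d] \<longrightarrow> 2 \<le> weight [a, b, c, d]) ?C) ?C) ?C) ?C"
    by code_simp
  obtain a b c d where abcd: "cs = [a, b, c, d]"
    using len by (auto simp: numeral_eq_Suc length_Suc_conv)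
  \<comment> \<open>Admissibility restricts the middle column of a window, and each of
    \<open>a\<close>, \<open>b\<close>, \<open>c\<close>, \<open>d\<close> is the middle of one, so
    the enumeration covers \<open>cs\<close>.\<close>
  have adm: "admissible x y z \<Longrightarrow> y \<in> set ?C" for x y z
    by (cases x; cases y; cases z) auto
  have "a \<in> set ?C" "b \<in> set ?C" "c \<in> set ?C" "d \<in> set ?C"
    using cs by (auto simp: abcd majority_roman_word_def pad_def simp del: admissible.simps dest!: adm)
  with * cs show ?thesis
    unfolding list_all_iff abcd by blast
qed

section \<open>The upper bound for all other lengths\<close>

lemma majority_roman_domination_number_grid_le_one:
  assumes "1 \<le> n" "n \<noteq> 4"
  shows "majority_roman_domination_number (grid_graph 2 n) \<le> 1"
proof -
  have word: ?thesis if "majority_roman_word cs" "length cs = n" "weight cs = 1" for cs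
    using majority_roman_domination_number_le_weight that by metis
  \<comment> \<open>The constants 2, 3, 5 and 8 represent all residues modulo 4 and miss only 1 and
    4 among the positive integers. They are the lengths of the words below at \<open>k = 0\<close>;
    there each word has weight 1 and exactly as many satisfied vertices as columns, and every block
    preserves this balance.\<close>
  have "n = 1 \<or> (\<exists>k. n = 4 * k + 2 \<or> n = 4 * k + 3 \<or> n = 4 * k + 5 \<or> n = 4 * k + 8)"
    using assms by presburger
  then consider "n = 1" | k where "n = 4 * k + 2" | k where "n = 4 * k + 3"
    | k where "n = 4 * k + 5" | k where "n = 4 * k + 8"
    by blast
  then show ?thesis
  proof cases
    case 1
    then show ?thesis
      by (intro word[of "[(- 1, 2)]"]) (simp_all add: majority_roman_word_def pad_def)
  next
    case 2
    then show ?thesis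
      by (intro word[of "(1, - 1) # (- 1, 2) # blocks k"])
        (simp_all add: word_blocks_simps weight_blocks[of _ "[]", simplified])
  next
    case 3
    then show ?thesis
      by (intro word[of "(1, - 1) # (- 1, 2) # blocks k @ [(1, - 1)]"])
        (simp_all add: word_blocks_simps)
  next
    case 4
    then show ?thesis
      \<comment> \<open>The three final columns have weight 0: the column \<open>(2, 2)\<close> pays
        for, and Roman-dominates, both columns beside it.\<close>
      by (intro word[of "(1, - 1) # (- 1, 2) # blocks k @ [(- 1, - 1), (2, 2), (- 1, - 1)]"])
        (simp_all add: word_blocks_simps)
  next
    case 5
    then show ?thesis
      \<comment> \<open>The same three columns of weight 0 are placed at both ends.\<close>
      by (intro word[of "(- 1, - 1) # (2, 2) # (- 1, - 1) # (1, - 1) # (- 1, 2) # blocks k @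
          [(- 1, - 1), (2, 2), (- 1, - 1)]"])
        (simp_all add: word_blocks_simps)
  qed
qed

theorem theorem7:
  shows "majority_roman_domination_number (grid_graph 2 4) = 2 \<and>
    (\<forall>n::nat. n \<ge> 1 \<and> n \<noteq> 4 \<longrightarrow> majority_roman_domination_number (grid_graph 2 n) \<le> 1)"
proof (intro conjI allI impI antisym)
  \<comment> \<open>A word of weight 2 in which five of the eight vertices have neighborhood sum at
    least 1.\<close>
  have "majority_roman_word [(- 1, 1), (2, 1), (- 1, - 1), (- 1, 2)]"
    by (simp add: majority_roman_word_def pad_def)
  from majority_roman_domination_number_le_weight[OF this, of 4]
  show "majority_roman_domination_number (grid_graph 2 4) \<le> 2" by simp
  show "2 \<le> majority_roman_domination_number (grid_graph 2 4)"
    by (rule majority_roman_domination_number_ge) (rule weight_ge_two_of_four_columns)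
qed (use majority_roman_domination_number_grid_le_one in blast)

end
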